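(* Let $(X,\|\cdot\|)$ be a normed linear space and let $C\subseteq X$ be a convex subset (i.e. $x,y\in C$ implies $(1-t)x+ty\in C$ for all $t\in[0,1]$). Then $C$ is round in the subspace topology. In particular, every normed linear space is round.
   Context: For a metric space $(Y,d)$, $y\in Y$ and $r>0$, write $B_d(y,r)=\{z\in Y: d(y,z)<r\}$ and $B_d[y,r]=\{z\in Y: d(y,z)\le r\}$. The metric $d$ is a round metric for $Y$ if the closure of $B_d(y,r)$ in $Y$ equals $B_d[y,r]$ for all $y\in Y$ and $r>0$. A metrizable space is round if its topology is induced by a round metric. A subset of a normed space carries the subspace topology of the topology induced by the norm. *)

theory Defs
  imports "HOL-Analysis.Analysis"
begin

text \<open>The locale \<^locale>\<open>Metric_space\<close> also asks \<open>d\<close> to be nonnegative and symmetric off the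
  carrier; this does not affect \<open>round_space\<close> below, where \<open>d\<close> is existentially quantified and
  its values off the carrier are irrelevant.\<close>

definition round_metric :: "'a set \<Rightarrow> ('a \<Rightarrow> 'a \<Rightarrow> real) \<Rightarrow> bool" where
  "round_metric Y d \<longleftrightarrow>
     Metric_space Y d \<and>
     (\<forall>y\<in>Y. \<forall>r>0.
        Metric_space.mtopology Y d closure_of Metric_space.mball Y d y r =
        Metric_space.mcball Y d y r)"

definition round_space :: "'a topology \<Rightarrow> bool" where
  "round_space T \<longleftrightarrow>
     (\<exists>d. round_metric (topspace T) d \<and> Metric_space.mtopology (topspace T) d = T)"

end

theory Submission
  imports Defs
begin

text \<open>
  The norm metric itself, restricted to the convex set, is round. Its topology is the subspace
  topology, and a closed ball is closed and so contains the closure of the open ball. For the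
  converse, a point \<open>z\<close> with \<open>dist y z \<le> r\<close> is approached along the segment from \<open>y\<close>: every point
  of the segment other than \<open>z\<close> is at distance less than \<open>r\<close> from \<open>y\<close>, and convexity keeps the
  segment inside the set. The whole space is the convex set \<open>UNIV\<close>.
\<close>

lemma Metric_space_dist: "Metric_space S dist"
  for S :: "'a::metric_space set"
  by (simp add: Metric_space_def dist_commute dist_triangle)

lemma mtopology_dist_eq_top_of_set: "Metric_space.mtopology S dist = top_of_set S"
  for S :: "'a::metric_space set"
proof -
  interpret Submetric UNIV dist S
    by unfold_locales auto
  show ?thesis
    using mtopology_submetric by simp
qed

text \<open>The affine parametrisation of the segment is continuous, and \<open>1\<close> is a limit of parameters
  in \<open>{0<..<1}\<close>.\<close>

lemma end_in_closure_open_segment: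
  fixes a b :: "'a::real_normed_vector"
  assumes "a \<noteq> b"
  shows "b \<in> closure (open_segment a b)"
proof -
  let ?f = "\<lambda>u::real. (1 - u) *\<^sub>R a + u *\<^sub>R b"
  have "?f ` closure {0<..<1} \<subseteq> closure (?f ` {0<..<1})"
    by (intro image_closure_subset continuous_intros closed_closure closure_subset)
  moreover have "b \<in> ?f ` closure {0<..<1}"
    by (rule image_eqI[of _ _ 1]) auto
  ultimately show ?thesis
    using assms by (auto simp: open_segment_image_interval)
qed

text \<open>The open segment from the centre approaches its endpoint. The radius must be positive:
  otherwise the ball is empty and its closure misses the centre.\<close>

lemma convex_in_closure_ball:
  fixes C :: "'a::real_normed_vector set"
  assumes "convex C" "y \<in> C" "z \<in> C" "dist y z \<le> r" "0 < r"
  shows "z \<in> closure (C \<inter> ball y r)"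
proof (cases "y = z")
  case True
  then show ?thesis
    using assms closure_subset[of "C \<inter> ball y r"] by auto
next
  case False
  have seg: "open_segment y z \<subseteq> C \<inter> ball y r"
  proof
    fix x assume x: "x \<in> open_segment y z"
    then have "x \<in> C"
      using assms(1-3) convex_contains_open_segment by blast
    moreover have "dist y x < r"
      using open_segment_bound1[OF x] assms(4) by (simp add: dist_norm norm_minus_commute)
    ultimately show "x \<in> C \<inter> ball y r"
      by simp
  qed
  have "z \<in> closure (open_segment y z)"
    using False by (rule end_in_closure_open_segment)
  then show ?thesis
    using closure_mono[OF seg] by blast
qed

lemma convex_round_metric_dist:
  fixes C :: "'a::real_normed_vector set"
  assumes "convex C"
  shows "round_metric C dist"
  unfolding round_metric_def
proof (intro conjI ballI allI impI)
  show "Metric_space C dist"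
    by (rule Metric_space_dist)
  then interpret Metric_space C dist .
  fix y and r :: real
  assume "y \<in> C" "0 < r"
  then have ball: "mball y r = C \<inter> ball y r" and cball: "mcball y r = C \<inter> cball y r"
    by auto
  have "closure (C \<inter> ball y r) \<subseteq> cball y r"
    by (rule closure_minimal) auto
  moreover have "C \<inter> cball y r \<subseteq> closure (C \<inter> ball y r)"
    using convex_in_closure_ball[OF assms \<open>y \<in> C\<close>] \<open>0 < r\<close> by auto
  ultimately show "mtopology closure_of mball y r = mcball y r"
    unfolding ball cball mtopology_dist_eq_top_of_set
    by (auto simp: closure_of_subtopology)
qed

lemma convex_round_space:
  fixes C :: "'a::real_normed_vector set"
  assumes "convex C"
  shows "round_space (top_of_set C)"
  unfolding round_space_def
  using convex_round_metric_dist[OF assms] mtopology_dist_eq_top_of_set[of C] by auto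

theorem theorem3p1:
  shows "(\<forall>C :: 'a::real_normed_vector set. convex C \<longrightarrow> round_space (top_of_set C)) \<and>
         round_space (euclidean :: 'a topology)"
  using convex_round_space convex_round_space[OF convex_UNIV] by auto

end
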